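(* Let $\mathbf{A}$ and $\mathbf{B}$ be independent random real $N\times N$ matrices. Assume that $\mathbf{B}$ is orthogonally invariant, i.e. $\mathbf{u}\mathbf{B}\mathbf{u}^\top\stackrel{d}{=}\mathbf{B}$ for every deterministic orthogonal $N\times N$ matrix $\mathbf{u}$. Then, for every $k=1,\ldots,N$, $$(\mathbf{A}\mathbf{B}\mathbf{A}^\top)^{[k]}\stackrel{d}{=}\left((\mathbf{A}\mathbf{A}^\top)^{[k]}\right)^{1/2}\,\mathbf{B}^{[k]}\,\left((\mathbf{A}\mathbf{A}^\top)^{[k]}\right)^{1/2}.$$
   Context: For an $N\times N$ matrix $\mathbf{x}$, $\mathbf{x}^{[k]}=(\mathbf{x}_{ij})_{i,j\le k}$ denotes its $k\times k$ leading principal submatrix. For a symmetric positive semidefinite matrix, $(\cdot)^{1/2}$ is the symmetric positive semidefinite square root. $\stackrel{d}{=}$ denotes equality in distribution. *)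

theory Defs
  imports
    "HOL-Probability.Probability"
    "Jordan_Normal_Form.Matrix"
    "Jordan_Normal_Form.DL_Submatrix"
begin

text \<open>
  The Borel sigma-algebra on real matrices of size \<open>nr \<times> nc\<close>, i.e. the one
  pulled back from the product Borel sigma-algebra along the map sending a
  matrix to its family of entries.  Only its sets matter; the measure that
  \<^const>\<open>vimage_algebra\<close> attaches to it is irrelevant.
\<close>
definition borel_mat :: "nat \<Rightarrow> nat \<Rightarrow> real mat measure" where
  "borel_mat nr nc =
     vimage_algebra (carrier_mat nr nc)
       (\<lambda>X. \<lambda>ij\<in>{..<nr} \<times> {..<nc}. X $$ ij)
       (\<Pi>\<^sub>M ij\<in>{..<nr} \<times> {..<nc}. (borel :: real measure))"

lemma space_borel_mat: "space (borel_mat nr nc) = carrier_mat nr nc"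
  by (simp add: borel_mat_def)

lemma measurable_borel_mat_iff:
  "X \<in> measurable M (borel_mat nr nc) \<longleftrightarrow>
     X \<in> space M \<rightarrow> carrier_mat nr nc \<and>
     (\<forall>i<nr. \<forall>j<nc. (\<lambda>\<omega>. X \<omega> $$ (i, j)) \<in> borel_measurable M)"
  (is "?L \<longleftrightarrow> ?R")
proof -
  let ?I = "{..<nr} \<times> {..<nc}"
  let ?f = "\<lambda>X :: real mat. \<lambda>ij\<in>?I. X $$ ij"
  have f: "?f \<in> measurable (borel_mat nr nc) (\<Pi>\<^sub>M ij\<in>?I. borel)"
    unfolding borel_mat_def by (rule measurable_vimage_algebra1) (auto simp: space_PiM)
  show ?thesis
  proof
    assume L: ?L
    have "(\<lambda>\<omega>. X \<omega> $$ (i, j)) \<in> borel_measurable M" if "i < nr" "j < nc" for i j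
    proof -
      have "(\<lambda>\<omega>. ?f (X \<omega>) (i, j)) \<in> borel_measurable M"
        using measurable_compose[OF measurable_compose[OF L f]
            measurable_component_singleton[of "(i, j)" ?I "\<lambda>_. borel"]] that by simp
      then show ?thesis using that by simp
    qed
    then show ?R using measurable_space[OF L] by (auto simp: space_borel_mat)
  next
    assume R: ?R
    have "(\<lambda>\<omega>. ?f (X \<omega>)) \<in> measurable M (\<Pi>\<^sub>M ij\<in>?I. borel)"
      using R by (intro measurable_restrict) auto
    then show ?L
      unfolding borel_mat_def using R by (intro measurable_vimage_algebra2) auto
  qed
qed

definition eq_in_distr :: "'a measure \<Rightarrow> 'b measure \<Rightarrow> ('a \<Rightarrow> 'b) \<Rightarrow> ('a \<Rightarrow> 'b) \<Rightarrow> bool" where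
  "eq_in_distr M L X Y \<longleftrightarrow>
     X \<in> measurable M L \<and> Y \<in> measurable M L \<and> distr M L X = distr M L Y"

text \<open>
  The library's \<^const>\<open>orthogonal_mat\<close> only asks for pairwise orthogonal
  nonzero columns, not for unit columns, hence a separate notion.
\<close>
definition orthogonal_matrix_real :: "nat \<Rightarrow> real mat \<Rightarrow> bool" where
  "orthogonal_matrix_real n U \<longleftrightarrow>
     U \<in> carrier_mat n n \<and> U * U\<^sup>T = 1\<^sub>m n \<and> U\<^sup>T * U = 1\<^sub>m n"

definition orthogonally_invariant :: "'a measure \<Rightarrow> nat \<Rightarrow> ('a \<Rightarrow> real mat) \<Rightarrow> bool" where
  "orthogonally_invariant M n X \<longleftrightarrow>
     (\<forall>U. orthogonal_matrix_real n U \<longrightarrow>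
        eq_in_distr M (borel_mat n n) (\<lambda>\<omega>. U * X \<omega> * U\<^sup>T) X)"

text \<open>Rows and columns are counted from 0, so the first \<open>k\<close> indices are \<open>{..<k}\<close>.\<close>
definition leading_submatrix :: "'a mat \<Rightarrow> nat \<Rightarrow> 'a mat" where
  "leading_submatrix X k = submatrix X {..<k} {..<k}"

lemma pick_lessThan: "i < k \<Longrightarrow> pick {..<k} i = i"
proof (induction i)
  case 0
  then show ?case by (simp add: Least_equality)
next
  case (Suc i)
  then show ?case by (auto intro!: Least_equality)
qed

lemma leading_submatrix_eq:
  assumes "X \<in> carrier_mat n n" "k \<le> n"
  shows "leading_submatrix X k = mat k k (\<lambda>(i, j). X $$ (i, j))"
proof -
  have I: "{i. i < dim_row X \<and> i \<in> {..<k}} = {..<k}" "{j. j < dim_col X \<and> j \<in> {..<k}} = {..<k}"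
    using assms by auto
  show ?thesis
    unfolding leading_submatrix_def submatrix_def I card_lessThan
    by (rule cong_mat) (simp_all add: pick_lessThan)
qed

definition psd_mat :: "nat \<Rightarrow> real mat \<Rightarrow> bool" where
  "psd_mat n S \<longleftrightarrow>
     S \<in> carrier_mat n n \<and> S\<^sup>T = S \<and> (\<forall>v\<in>carrier_vec n. 0 \<le> scalar_prod v (S *\<^sub>v v))"

text \<open>Meaningful only for symmetric positive semidefinite \<open>S\<close>, where the root exists and is unique.\<close>
definition psd_sqrt :: "real mat \<Rightarrow> real mat" where
  "psd_sqrt S = (THE R. psd_mat (dim_row S) R \<and> R * R = S)"

end

theory Submission
  imports Defs
begin

text \<open>
  Fix a value \<open>a\<close> of \<open>A\<close> and let \<open>C\<close> consist of its first \<open>k\<close> rows, so that the leading submatrices of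
  \<open>a b a\<^sup>T\<close> and \<open>a a\<^sup>T\<close> are \<open>C b C\<^sup>T\<close> and \<open>C C\<^sup>T\<close>. Let \<open>R\<close> be the positive semidefinite root of
  \<open>C C\<^sup>T\<close> and \<open>P\<close> the projection onto the first \<open>k\<close> coordinates. Then \<open>C\<close> and \<open>R P\<close> have the same Gram
  matrix of rows, hence \<open>C = R P U\<close> for some orthogonal \<open>U\<close> (\<open>polar_decomposition\<close>), and
  \<open>C b C\<^sup>T = R (P (U b U\<^sup>T) P\<^sup>T) R\<close> for every \<open>b\<close> (\<open>leading_submatrix_sandwich\<close>). Inserting \<open>b = B\<close> and
  using that \<open>U B U\<^sup>T\<close> has the law of \<open>B\<close>, the claim follows for constant \<open>A\<close>.

  By independence this suffices: the law of a function of \<open>(A, B)\<close> is the average over \<open>a\<close> of the laws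
  with \<open>A\<close> replaced by \<open>a\<close> (\<open>eq_in_distr_of_indep_var\<close>). The matrix \<open>U\<close> is used for one \<open>a\<close> at a time,
  so it need not be chosen measurably in \<open>a\<close>. The square root, however, must be measurable, and it is a
  definite description, so that existence and uniqueness are needed as well.

  All this is done without the spectral theorem. The orthogonal matrix is a product of Householder
  reflections (\<open>orthogonal_matrix_moving_family\<close>). The root is unique by a trace argument
  (\<open>psd_mat_sqrt_unique\<close>), and after scaling the matrix to the form \<open>1 - X\<close> with \<open>0 \<le> X \<le> 1\<close> it is the
  binomial series of \<open>sqrt (1 - x)\<close> evaluated at \<open>X\<close> (\<open>psd_sqrt_eq_scaled_sqrt_series\<close>). This one
  formula yields existence and measurability (\<open>measurable_psd_sqrt\<close>).
\<close>

unbundle no inner_syntax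
unbundle no vec_syntax

section \<open>Families of vectors with equal Gram matrices\<close>

lemma mat_eqI_mult_vec:
  fixes A B :: "'a :: semiring_1 mat"
  assumes A: "A \<in> carrier_mat nr nc" and B: "B \<in> carrier_mat nr nc"
    and eq: "\<And>v. v \<in> carrier_vec nc \<Longrightarrow> A *\<^sub>v v = B *\<^sub>v v"
  shows "A = B"
proof (rule eq_matI)
  fix i j assume ij: "i < dim_row B" "j < dim_col B"
  have "(A *\<^sub>v unit_vec nc j) $ i = (B *\<^sub>v unit_vec nc j) $ i"
    using eq[of "unit_vec nc j"] by simp
  with ij A B show "A $$ (i, j) = B $$ (i, j)" by simp
qed (use A B in auto)

lemma orthogonal_matrix_real_mult:
  assumes "orthogonal_matrix_real n U" "orthogonal_matrix_real n V"
  shows "orthogonal_matrix_real n (U * V)"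
proof -
  have c: "U \<in> carrier_mat n n" "V \<in> carrier_mat n n" "U\<^sup>T \<in> carrier_mat n n" "V\<^sup>T \<in> carrier_mat n n"
    and e: "U * U\<^sup>T = 1\<^sub>m n" "U\<^sup>T * U = 1\<^sub>m n" "V * V\<^sup>T = 1\<^sub>m n" "V\<^sup>T * V = 1\<^sub>m n"
    using assms by (auto simp: orthogonal_matrix_real_def)
  have "(U * V) * (U * V)\<^sup>T = U * (V * V\<^sup>T) * U\<^sup>T"
    using c by (simp add: transpose_mult[of _ n n] assoc_mult_mat[of _ n n _ n _ n])
  moreover have "(U * V)\<^sup>T * (U * V) = V\<^sup>T * (U\<^sup>T * U) * V"
    using c by (simp add: transpose_mult[of _ n n] assoc_mult_mat[of _ n n _ n _ n])
  ultimately show ?thesis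
    using c e by (simp add: orthogonal_matrix_real_def)
qed

lemma orthogonal_matrix_real_transpose:
  "orthogonal_matrix_real n U \<Longrightarrow> orthogonal_matrix_real n U\<^sup>T"
  by (auto simp: orthogonal_matrix_real_def)

lemma scalar_prod_orthogonal_matrix:
  assumes "orthogonal_matrix_real n U" "v \<in> carrier_vec n" "w \<in> carrier_vec n"
  shows "(U *\<^sub>v v) \<bullet> (U *\<^sub>v w) = v \<bullet> w"
proof -
  have U: "U \<in> carrier_mat n n" "U\<^sup>T * U = 1\<^sub>m n"
    using assms by (auto simp: orthogonal_matrix_real_def)
  have "v \<bullet> w = (U\<^sup>T *\<^sub>v (U *\<^sub>v v)) \<bullet> w"
    using U assms by (simp flip: assoc_mult_mat_vec[of _ n n _ n])
  also have "\<dots> = (U *\<^sub>v v) \<bullet> (U *\<^sub>v w)"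
    by (rule transpose_vec_mult_scalar) (use U assms in auto)
  finally show ?thesis by simp
qed

text \<open>
  The Householder reflection in the hyperplane orthogonal to \<open>u\<close>.
\<close>
definition reflection :: "nat \<Rightarrow> real vec \<Rightarrow> real mat" where
  "reflection n u = mat n n (\<lambda>(i, j). (if i = j then 1 else 0) - 2 / (u \<bullet> u) * (u $ i * u $ j))"

lemma reflection_mult_vec:
  assumes "u \<in> carrier_vec n" "x \<in> carrier_vec n"
  shows "reflection n u *\<^sub>v x = x - (2 / (u \<bullet> u) * (u \<bullet> x)) \<cdot>\<^sub>v u"
proof (rule eq_vecI)
  fix i assume "i < dim_vec (x - (2 / (u \<bullet> u) * (u \<bullet> x)) \<cdot>\<^sub>v u)"
  then have i: "i < n" using assms by simp
  define c where "c = 2 / (u \<bullet> u)"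
  have "(reflection n u *\<^sub>v x) $ i
      = (\<Sum>j = 0..<n. ((if i = j then 1 else 0) - c * (u $ i * u $ j)) * x $ j)"
    unfolding reflection_def c_def[symmetric] using i assms by (simp add: scalar_prod_def)
  also have "\<dots> = (\<Sum>j = 0..<n. (if i = j then 1 else 0) * x $ j)
      - (\<Sum>j = 0..<n. (c * u $ i) * (u $ j * x $ j))"
    by (simp add: algebra_simps sum_subtractf)
  also have "(\<Sum>j = 0..<n. (if i = j then 1 else 0) * x $ j) = x $ i"
    using i by (simp add: if_distrib[of "\<lambda>c. c * _"] cong: if_cong)
  also have "(\<Sum>j = 0..<n. (c * u $ i) * (u $ j * x $ j)) = c * u $ i * (u \<bullet> x)"
    using assms unfolding sum_distrib_left[symmetric] by (simp add: scalar_prod_def)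
  finally show "(reflection n u *\<^sub>v x) $ i = (x - (2 / (u \<bullet> u) * (u \<bullet> x)) \<cdot>\<^sub>v u) $ i"
    using i assms by (simp add: c_def)
qed (use assms in \<open>auto simp: reflection_def\<close>)

lemma reflection_fix:
  assumes "u \<in> carrier_vec n" "x \<in> carrier_vec n" "u \<bullet> x = 0"
  shows "reflection n u *\<^sub>v x = x"
  using assms by (intro eq_vecI) (auto simp: reflection_mult_vec)

lemma scalar_prod_self_nonneg: "0 \<le> (v :: real vec) \<bullet> v"
  by (simp add: scalar_prod_def sum_nonneg)

lemma scalar_prod_self_eq_0_iff:
  assumes "(v :: real vec) \<in> carrier_vec n"
  shows "v \<bullet> v = 0 \<longleftrightarrow> v = 0\<^sub>v n"
proof
  assume "v \<bullet> v = 0"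
  then show "v = 0\<^sub>v n"
    using assms by (intro eq_vecI) (auto simp: scalar_prod_def sum_nonneg_eq_0_iff)
qed (use assms in simp)

lemma orthogonal_matrix_reflection:
  assumes u: "u \<in> carrier_vec n" "u \<noteq> 0\<^sub>v n"
  shows "orthogonal_matrix_real n (reflection n u)"
proof -
  let ?H = "reflection n u"
  have H: "?H \<in> carrier_mat n n" by (simp add: reflection_def)
  have T: "?H\<^sup>T = ?H" by (rule eq_matI) (auto simp: reflection_def)
  have uu: "u \<bullet> u \<noteq> 0" using u scalar_prod_self_eq_0_iff by blast
  have "?H * ?H = 1\<^sub>m n"
  proof (rule mat_eqI_mult_vec)
    fix v :: "real vec" assume v: "v \<in> carrier_vec n"
    define c where "c = 2 / (u \<bullet> u) * (u \<bullet> v)"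
    have "u \<bullet> (v - c \<cdot>\<^sub>v u) = u \<bullet> v - c * (u \<bullet> u)"
      using u v by (simp add: scalar_prod_minus_distrib[of _ n])
    also have "\<dots> = - (u \<bullet> v)" using uu by (simp add: c_def)
    finally have "?H *\<^sub>v (?H *\<^sub>v v) = v - c \<cdot>\<^sub>v u - (- c) \<cdot>\<^sub>v u"
      using u v by (simp add: reflection_mult_vec c_def)
    also have "\<dots> = v" using u v by (intro eq_vecI) auto
    finally show "(?H * ?H) *\<^sub>v v = 1\<^sub>m n *\<^sub>v v"
      using H v by simp
  qed (use H in auto)
  then show ?thesis using H T by (simp add: orthogonal_matrix_real_def)
qed

lemma vec_diff_eq_0D:
  fixes x y :: "'a :: ab_group_add vec"
  assumes "x \<in> carrier_vec n" "y \<in> carrier_vec n" "x - y = 0\<^sub>v n"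
  shows "x = y"
proof (rule eq_vecI)
  fix i assume "i < dim_vec y"
  with assms have "i < n" "(x - y) $ i = 0" by auto
  then show "x $ i = y $ i" using assms(1,2) by simp
qed (use assms in auto)

text \<open>
  Two distinct vectors of the same length are exchanged by the reflection in the hyperplane that
  bisects them; this is what makes reflections a tool for moving one vector to another.
\<close>
lemma reflection_swap:
  assumes x: "x \<in> carrier_vec n" and y: "y \<in> carrier_vec n" and eq: "x \<bullet> x = y \<bullet> y"
    and ne: "x \<noteq> y"
  shows "reflection n (x - y) *\<^sub>v x = y"
proof -
  let ?u = "x - y"
  have yx: "y \<bullet> x = x \<bullet> y" using x y by (rule comm_scalar_prod[symmetric])
  have u: "?u \<in> carrier_vec n" using x y by simp
  have ne: "?u \<noteq> 0\<^sub>v n" using vec_diff_eq_0D[OF x y] ne by blast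
  have "?u \<bullet> ?u = 2 * (?u \<bullet> x)"
    using x y u yx eq by (simp add: scalar_prod_minus_distrib[of _ n] minus_scalar_prod_distrib[of _ n])
  moreover have "?u \<bullet> ?u \<noteq> 0" using u ne scalar_prod_self_eq_0_iff by blast
  ultimately have "reflection n ?u *\<^sub>v x = x - 1 \<cdot>\<^sub>v ?u"
    using x u by (simp add: reflection_mult_vec)
  also have "\<dots> = y" using x y by (intro eq_vecI) auto
  finally show ?thesis .
qed

text \<open>
  The vectors are brought into position one at a time. Once \<open>h 0, \<dots>, h (k - 1)\<close> are in place, the image of
  the next vector \<open>h k\<close> has the same length as \<open>g k\<close> and the same scalar products with the vectors
  already placed. Hence the difference of the two is orthogonal to those, so the reflection that
  exchanges the two leaves everything placed before untouched. No basis has to be chosen or completed.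
\<close>
lemma orthogonal_matrix_moving_family:
  fixes g h :: "nat \<Rightarrow> real vec"
  assumes "\<And>i. i < k \<Longrightarrow> g i \<in> carrier_vec n" "\<And>i. i < k \<Longrightarrow> h i \<in> carrier_vec n"
    and "\<And>i j. i < k \<Longrightarrow> j < k \<Longrightarrow> g i \<bullet> g j = h i \<bullet> h j"
  shows "\<exists>W. orthogonal_matrix_real n W \<and> (\<forall>i<k. W *\<^sub>v h i = g i)"
  using assms
proof (induction k)
  case 0
  show ?case by (rule exI[of _ "1\<^sub>m n"]) (simp add: orthogonal_matrix_real_def)
next
  case (Suc k)
  then obtain W where W: "orthogonal_matrix_real n W" "\<And>i. i < k \<Longrightarrow> W *\<^sub>v h i = g i"
    by (metis less_SucI)
  let ?x = "W *\<^sub>v h k"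
  have Wc: "W \<in> carrier_mat n n" using W by (simp add: orthogonal_matrix_real_def)
  have x: "?x \<in> carrier_vec n" using Wc Suc.prems by auto
  have gk: "g k \<in> carrier_vec n" using Suc.prems by auto
  have inner: "?x \<bullet> g i = g k \<bullet> g i" if "i < k" for i
    using that Suc.prems W scalar_prod_orthogonal_matrix[OF W(1), of "h k" "h i"] by auto
  have len: "?x \<bullet> ?x = g k \<bullet> g k"
    using Suc.prems scalar_prod_orthogonal_matrix[OF W(1), of "h k" "h k"] by auto
  show ?case
  proof (cases "?x = g k")
    case True
    then show ?thesis using W by (metis less_Suc_eq)
  next
    case False
    let ?u = "?x - g k"
    let ?H = "reflection n ?u"
    have u: "?u \<in> carrier_vec n" using x gk by simp
    have Hc: "?H \<in> carrier_mat n n" by (simp add: reflection_def)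
    have swap: "?H *\<^sub>v ?x = g k" using x gk len False by (rule reflection_swap)
    have u0: "?u \<noteq> 0\<^sub>v n" using vec_diff_eq_0D[OF x gk] False by blast
    have fix_g: "?H *\<^sub>v g i = g i" if "i < k" for i
    proof -
      have gi: "g i \<in> carrier_vec n" using Suc.prems that by auto
      have "?u \<bullet> g i = 0"
        using inner[OF that] x gk gi by (simp add: minus_scalar_prod_distrib[of _ n])
      then show ?thesis using u gi by (intro reflection_fix)
    qed
    have "(?H * W) *\<^sub>v h i = g i" if "i < Suc k" for i
    proof -
      have "(?H * W) *\<^sub>v h i = ?H *\<^sub>v (W *\<^sub>v h i)"
        using Hc Wc Suc.prems(2)[OF that] by simp
      then show ?thesis using that swap fix_g W by (cases "i = k") auto
    qed
    moreover have "orthogonal_matrix_real n (?H * W)"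
      using orthogonal_matrix_real_mult orthogonal_matrix_reflection[OF u u0] W by blast
    ultimately show ?thesis by blast
  qed
qed

lemma orthogonal_matrix_of_equal_gram:
  assumes G: "G \<in> carrier_mat n k" and H: "H \<in> carrier_mat n k" and eq: "G\<^sup>T * G = H\<^sup>T * H"
  shows "\<exists>W. orthogonal_matrix_real n W \<and> W * H = G"
proof -
  have "col G i \<bullet> col G j = col H i \<bullet> col H j" if "i < k" "j < k" for i j
  proof -
    have "(G\<^sup>T * G) $$ (i, j) = (H\<^sup>T * H) $$ (i, j)" by (simp add: eq)
    then show ?thesis using that G H by simp
  qed
  then obtain W where W: "orthogonal_matrix_real n W" "\<And>i. i < k \<Longrightarrow> W *\<^sub>v col H i = col G i"
    using orthogonal_matrix_moving_family[of k "col G" n "col H"] G H by auto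
  have Wc: "W \<in> carrier_mat n n" using W by (simp add: orthogonal_matrix_real_def)
  have "W * H = G"
  proof (rule eq_matI)
    fix i j assume ij: "i < dim_row G" "j < dim_col G"
    then have "(W *\<^sub>v col H j) $ i = col G j $ i" using W G by simp
    then show "(W * H) $$ (i, j) = G $$ (i, j)" using ij G H Wc by simp
  qed (use G H Wc in auto)
  then show ?thesis using W by blast
qed

section \<open>Uniqueness of the positive semidefinite square root\<close>

lemma quadratic_form_eq_sum:
  fixes A :: "'a :: comm_semiring_0 mat"
  assumes "A \<in> carrier_mat n n" "v \<in> carrier_vec n" "w \<in> carrier_vec n"
  shows "v \<bullet> (A *\<^sub>v w) = (\<Sum>i<n. \<Sum>j<n. v $ i * w $ j * A $$ (i, j))"
proof -
  have "v \<bullet> (A *\<^sub>v w) = (\<Sum>i\<in>{0..<n}. v $ i * (\<Sum>j\<in>{0..<n}. A $$ (i, j) * w $ j))"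
    using assms by (simp add: scalar_prod_def)
  then show ?thesis
    by (simp add: sum_distrib_left atLeast0LessThan mult_ac)
qed

lemma scalar_prod_symmetric_mat:
  fixes S :: "'a :: comm_semiring_0 mat"
  assumes "S \<in> carrier_mat n n" "S\<^sup>T = S" "v \<in> carrier_vec n" "w \<in> carrier_vec n"
  shows "(S *\<^sub>v v) \<bullet> w = v \<bullet> (S *\<^sub>v w)"
  using transpose_vec_mult_scalar[OF assms(1,4,3)] assms(2) by simp

text \<open>
  If \<open>w = R v\<close> were nonzero, the quadratic form at \<open>v - s w\<close> would be \<open>- 2 s (w \<bullet> w) + s\<^sup>2 (w \<bullet> R w)\<close>,
  which is negative for small positive \<open>s\<close>.
\<close>
lemma psd_mat_kernel:
  assumes R: "psd_mat n R" and v: "v \<in> carrier_vec n" and 0: "v \<bullet> (R *\<^sub>v v) = 0"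
  shows "R *\<^sub>v v = 0\<^sub>v n"
proof (rule ccontr)
  define w where "w = R *\<^sub>v v"
  assume "R *\<^sub>v v \<noteq> 0\<^sub>v n"
  have Rc: "R \<in> carrier_mat n n" "R\<^sup>T = R" and pos: "\<And>v. v \<in> carrier_vec n \<Longrightarrow> 0 \<le> v \<bullet> (R *\<^sub>v v)"
    using R by (auto simp: psd_mat_def)
  have w: "w \<in> carrier_vec n" and Rw: "R *\<^sub>v w \<in> carrier_vec n" using Rc v by (auto simp: w_def)
  define a where "a = w \<bullet> w"
  define b where "b = w \<bullet> (R *\<^sub>v w)"
  have a: "a > 0"
    using \<open>R *\<^sub>v v \<noteq> 0\<^sub>v n\<close> scalar_prod_self_eq_0_iff[OF w] scalar_prod_self_nonneg[of w]
    by (simp add: a_def w_def)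
  have b: "b \<ge> 0" using pos[OF w] by (simp add: b_def)
  \<comment> \<open>Small enough for \<open>s * b \<le> a\<close>, also when \<open>b = 0\<close>.\<close>
  define s where "s = a / (1 + b)"
  have s: "s > 0" using a b by (simp add: s_def)
  have "v \<bullet> (R *\<^sub>v w) = a"
    using scalar_prod_symmetric_mat[OF Rc v w] by (simp add: a_def w_def)
  moreover have "R *\<^sub>v (v - s \<cdot>\<^sub>v w) = w - s \<cdot>\<^sub>v (R *\<^sub>v w)"
    using Rc v w by (simp add: mult_minus_distrib_mat_vec[of _ n n] mult_mat_vec[of _ n n] w_def)
  ultimately have "(v - s \<cdot>\<^sub>v w) \<bullet> (R *\<^sub>v (v - s \<cdot>\<^sub>v w)) = s * (s * b - 2 * a)"
    using v w Rw 0
    by (simp add: scalar_prod_minus_distrib[of _ n] minus_scalar_prod_distrib[of _ n]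
        flip: w_def a_def b_def) (simp add: algebra_simps)
  moreover have "0 \<le> (v - s \<cdot>\<^sub>v w) \<bullet> (R *\<^sub>v (v - s \<cdot>\<^sub>v w))"
    using v w by (intro pos) simp
  ultimately have "2 * a \<le> s * b" using s by (simp add: zero_le_mult_iff)
  moreover have "s * b \<le> a" using a b by (simp add: s_def field_simps)
  ultimately show False using a by simp
qed

lemma sum_diag_mult_commute:
  fixes A B :: "'a :: comm_semiring_0 mat"
  assumes "A \<in> carrier_mat n m" "B \<in> carrier_mat m n"
  shows "(\<Sum>i<n. (A * B) $$ (i, i)) = (\<Sum>i<m. (B * A) $$ (i, i))"
proof -
  have "(\<Sum>i<n. (A * B) $$ (i, i)) = (\<Sum>i<n. \<Sum>j<m. A $$ (i, j) * B $$ (j, i))"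
    using assms by (simp add: scalar_prod_def atLeast0LessThan)
  also have "\<dots> = (\<Sum>j<m. \<Sum>i<n. B $$ (j, i) * A $$ (i, j))"
    by (subst sum.swap) (simp add: mult.commute)
  also have "\<dots> = (\<Sum>i<m. (B * A) $$ (i, i))"
    using assms by (simp add: scalar_prod_def atLeast0LessThan)
  finally show ?thesis .
qed

text \<open>
  Let \<open>D = R - Q\<close>. Then \<open>R D + D Q = R\<^sup>2 - Q\<^sup>2 = 0\<close>, and multiplying by \<open>D\<close> and taking the trace
  gives \<open>tr (D R D) + tr (D Q D) = 0\<close>. Both traces are sums of nonnegative values of quadratic forms
  at the columns of \<open>D\<close>, so \<open>R\<close> and \<open>Q\<close> annihilate these columns, hence so does \<open>D\<close>; as \<open>D\<close> is
  symmetric, each column of \<open>D\<close> is orthogonal to itself. The two roots are thus compared without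
  diagonalizing them and without knowing that they commute.
\<close>
lemma psd_mat_sqrt_unique:
  assumes R: "psd_mat n R" and Q: "psd_mat n Q" and eq: "R * R = Q * Q"
  shows "R = Q"
proof -
  define D where "D = R - Q"
  have Rc: "R \<in> carrier_mat n n" "R\<^sup>T = R" and Qc: "Q \<in> carrier_mat n n" "Q\<^sup>T = Q"
    using R Q by (auto simp: psd_mat_def)
  have D: "D \<in> carrier_mat n n" "D\<^sup>T = D"
    using Rc Qc by (auto simp: D_def transpose_minus[of _ n n])
  have row: "row D j = col D j" if "j < n" for j
    using that D by (metis carrier_matD(2) row_transpose)
  have diag: "(D * (S * D)) $$ (j, j) = col D j \<bullet> (S *\<^sub>v col D j)"
    if "j < n" "S \<in> carrier_mat n n" for S j
    using that D row by (simp add: col_mult2[of _ n n _ n])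
  have "R * D + D * Q = 0\<^sub>m n n"
  proof (rule eq_matI)
    fix i j assume "i < dim_row (0\<^sub>m n n :: real mat)" "j < dim_col (0\<^sub>m n n :: real mat)"
    then have ij: "i < n" "j < n" by auto
    have "R * D + D * Q = (R * R - R * Q) + (R * Q - R * R)"
      using Rc Qc by (simp add: D_def mult_minus_distrib_mat[of _ n n _ n] minus_mult_distrib_mat[of _ n n _ _ n] eq)
    then show "(R * D + D * Q) $$ (i, j) = 0\<^sub>m n n $$ (i, j)"
      using ij Rc Qc by simp
  qed (use Rc Qc D in auto)
  then have "D * (R * D) + D * (D * Q) = 0\<^sub>m n n"
    using D Rc Qc by (simp flip: mult_add_distrib_mat[of _ n n _ n])
  then have "(\<Sum>j<n. (D * (R * D) + D * (D * Q)) $$ (j, j)) = 0"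
    by simp
  also have "(\<Sum>j<n. (D * (R * D) + D * (D * Q)) $$ (j, j)) =
      (\<Sum>j<n. (D * (R * D)) $$ (j, j)) + (\<Sum>j<n. (D * (D * Q)) $$ (j, j))"
    using D Rc Qc by (simp add: sum.distrib del: index_mult_mat(1))
  also have "(\<Sum>j<n. (D * (D * Q)) $$ (j, j)) = (\<Sum>j<n. (D * (Q * D)) $$ (j, j))"
    using D Qc sum_diag_mult_commute[of D n n "D * Q"] by (simp add: assoc_mult_mat[of _ n n _ n _ n])
  finally have sum0: "(\<Sum>j<n. col D j \<bullet> (R *\<^sub>v col D j)) + (\<Sum>j<n. col D j \<bullet> (Q *\<^sub>v col D j)) = 0"
    using Rc Qc by (simp add: diag)
  have nonneg: "0 \<le> col D j \<bullet> (S *\<^sub>v col D j)" if "psd_mat n S" "j < n" for S j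
    using that D by (auto simp: psd_mat_def)
  have "(\<Sum>j<n. col D j \<bullet> (R *\<^sub>v col D j)) = 0" "(\<Sum>j<n. col D j \<bullet> (Q *\<^sub>v col D j)) = 0"
    using sum0 sum_nonneg[of "{..<n}" "\<lambda>j. col D j \<bullet> (R *\<^sub>v col D j)"]
      sum_nonneg[of "{..<n}" "\<lambda>j. col D j \<bullet> (Q *\<^sub>v col D j)"] nonneg[OF R] nonneg[OF Q] by auto
  moreover have "S *\<^sub>v col D j = 0\<^sub>v n"
    if "psd_mat n S" "(\<Sum>j<n. col D j \<bullet> (S *\<^sub>v col D j)) = 0" "j < n" for S j
  proof (rule psd_mat_kernel)
    show "col D j \<bullet> (S *\<^sub>v col D j) = 0"
      by (rule sum_nonneg_0[OF _ _ that(2)]) (use that nonneg[OF that(1)] in simp_all)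
  qed (use that D in auto)
  ultimately have kernel: "R *\<^sub>v col D j = 0\<^sub>v n" "Q *\<^sub>v col D j = 0\<^sub>v n" if "j < n" for j
    using R Q that by blast+
  have col0: "col D j = 0\<^sub>v n" if j: "j < n" for j
  proof -
    have "D *\<^sub>v col D j = 0\<^sub>v n"
      using kernel[OF j] Rc Qc D j unfolding D_def by (simp add: minus_mult_distrib_mat_vec[of _ n n])
    then have "(D *\<^sub>v col D j) $ j = 0" using j by simp
    then have "col D j \<bullet> col D j = 0" using j D row by simp
    then show ?thesis using scalar_prod_self_eq_0_iff[of "col D j" n] D j by auto
  qed
  show ?thesis
  proof (rule eq_matI)
    fix i j assume "i < dim_row Q" "j < dim_col Q"
    then have ij: "i < n" "j < n" using Qc by auto
    have "col D j $ i = 0" using col0 ij by simp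
    then show "R $$ (i, j) = Q $$ (i, j)" using ij Rc Qc by (simp add: D_def)
  qed (use Rc Qc in auto)
qed

lemma psd_sqrt_eqI:
  assumes "psd_mat n R" "R * R = S"
  shows "psd_sqrt S = R"
proof -
  have "dim_row S = n" using assms by (auto simp: psd_mat_def)
  then show ?thesis
    unfolding psd_sqrt_def using assms psd_mat_sqrt_unique by (intro the_equality) auto
qed

section \<open>The binomial series of \<open>sqrt (1 - x)\<close>\<close>

text \<open>
  The Taylor coefficients at 0 of \<open>sqrt (1 - x)\<close>.
\<close>
definition sqrt_coeff :: "nat \<Rightarrow> real" where
  "sqrt_coeff m = (1/2 gchoose m) * (- 1) ^ m"

lemma sqrt_coeff_0: "sqrt_coeff 0 = 1"
  by (simp add: sqrt_coeff_def)

lemma sqrt_coeff_nonpos: "m \<noteq> 0 \<Longrightarrow> sqrt_coeff m \<le> 0"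
proof (cases m)
  case (Suc j)
  have "sqrt_coeff m = pochhammer (- (1/2)) m / fact m"
    by (simp add: sqrt_coeff_def gbinomial_pochhammer power_mult_distrib[symmetric])
  also have "\<dots> = - (1/2) * pochhammer (1/2) j / fact m"
    unfolding Suc pochhammer_rec by simp
  also have "\<dots> \<le> 0"
    by (simp add: pochhammer_nonneg)
  finally show ?thesis .
qed simp

text \<open>
  The partial sums have the closed form \<open>pochhammer (1/2) m / fact m\<close>. Since only the constant
  coefficient is positive, a lower bound for the partial sums is what bounds the sums of absolute
  values; in the limit it is also the reason why the square root defined by the series is positive
  semidefinite.
\<close>
lemma sum_sqrt_coeff_nonneg: "0 \<le> (\<Sum>k\<le>m. sqrt_coeff k)"
proof -
  have "(\<Sum>k\<le>m. sqrt_coeff k) = (- 1) ^ m * (- (1/2) gchoose m)"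
    using gbinomial_sum_lower_neg[of "1/2 :: real" m] by (simp add: sqrt_coeff_def)
  also have "\<dots> = pochhammer (1/2) m / fact m"
    by (simp add: gbinomial_pochhammer power_mult_distrib[symmetric])
  also have "\<dots> \<ge> 0" by (simp add: pochhammer_nonneg)
  finally show ?thesis .
qed

lemma summable_abs_sqrt_coeff: "summable (\<lambda>m. \<bar>sqrt_coeff m\<bar>)"
proof (rule bounded_imp_summable)
  fix m
  \<comment> \<open>Only the constant coefficient 1 changes sign, which costs 2.\<close>
  have "\<bar>sqrt_coeff k\<bar> = (if k = 0 then 2 else 0) - sqrt_coeff k" for k
    using sqrt_coeff_nonpos[of k] by (auto simp: sqrt_coeff_0)
  then have "(\<Sum>k\<le>m. \<bar>sqrt_coeff k\<bar>) = 2 - (\<Sum>k\<le>m. sqrt_coeff k)"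
    by (simp add: sum_subtractf)
  also have "\<dots> \<le> 2" using sum_sqrt_coeff_nonneg[of m] by simp
  finally show "(\<Sum>k\<le>m. \<bar>sqrt_coeff k\<bar>) \<le> 2" .
qed simp

text \<open>
  The formal identity \<open>(sqrt (1 - x))\<^sup>2 = 1 - x\<close>, an instance of Vandermonde's convolution.
\<close>
lemma sqrt_coeff_convolution:
  "(\<Sum>q\<le>p. sqrt_coeff q * sqrt_coeff (p - q)) = (if p = 0 then 1 else if p = 1 then - 1 else 0)"
proof -
  have "(\<Sum>q\<le>p. sqrt_coeff q * sqrt_coeff (p - q))
      = (\<Sum>q\<le>p. (1/2 gchoose q) * (1/2 gchoose (p - q)) * (- 1) ^ p)"
  proof (rule sum.cong)
    fix q assume "q \<in> {..p}"
    then have "(- 1 :: real) ^ p = (- 1) ^ q * (- 1) ^ (p - q)"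
      by (simp flip: power_add)
    then show "sqrt_coeff q * sqrt_coeff (p - q) = (1/2 gchoose q) * (1/2 gchoose (p - q)) * (- 1) ^ p"
      by (simp add: sqrt_coeff_def)
  qed simp
  also have "\<dots> = ((1/2 + 1/2 :: real) gchoose p) * (- 1) ^ p"
    unfolding gbinomial_Vandermonde[symmetric] by (simp add: sum_distrib_right atLeast0AtMost)
  also have "(1/2 + 1/2 :: real) gchoose p = real (1 choose p)"
    by (simp add: binomial_gbinomial)
  finally show ?thesis
    by (cases p) (auto simp: binomial_eq_0)
qed

section \<open>Symmetric contractions\<close>

lemma pow_mat_add:
  assumes "A \<in> carrier_mat n n"
  shows "A ^\<^sub>m (a + b) = A ^\<^sub>m a * A ^\<^sub>m b"
proof (induction b)
  case 0
  then show ?case using assms by simp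
next
  case (Suc b)
  then show ?case using assms by (simp add: assoc_mult_mat[of _ n n _ n _ n])
qed

lemma transpose_pow_mat:
  fixes A :: "'a :: comm_semiring_1 mat"
  assumes A: "A \<in> carrier_mat n n"
  shows "(A ^\<^sub>m m)\<^sup>T = A\<^sup>T ^\<^sub>m m"
proof (induction m)
  case 0
  then show ?case using A by simp
next
  case (Suc m)
  have "(A ^\<^sub>m Suc m)\<^sup>T = A\<^sup>T ^\<^sub>m 1 * A\<^sup>T ^\<^sub>m m"
    using A Suc by (simp add: transpose_mult[of _ n n])
  also have "\<dots> = A\<^sup>T ^\<^sub>m (1 + m)"
    using A by (intro pow_mat_add[symmetric, of _ n]) simp
  finally show ?case by (simp del: pow_mat.simps)
qed

text \<open>
  Contractions are closed under powers and have entries bounded by 1, which is all that the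
  convergence of a power series with absolutely summable coefficients requires.
\<close>
definition contraction_mat :: "nat \<Rightarrow> real mat \<Rightarrow> bool" where
  "contraction_mat n X \<longleftrightarrow>
     X \<in> carrier_mat n n \<and> (\<forall>v\<in>carrier_vec n. (X *\<^sub>v v) \<bullet> (X *\<^sub>v v) \<le> v \<bullet> v)"

lemma contraction_mat_pow:
  assumes X: "contraction_mat n X"
  shows "contraction_mat n (X ^\<^sub>m m)"
proof (induction m)
  case 0
  then show ?case using X by (auto simp: contraction_mat_def)
next
  case (Suc m)
  have "(X ^\<^sub>m Suc m *\<^sub>v v) \<bullet> (X ^\<^sub>m Suc m *\<^sub>v v) \<le> v \<bullet> v" if v: "v \<in> carrier_vec n" for v
  proof -
    have "X ^\<^sub>m Suc m *\<^sub>v v = X ^\<^sub>m m *\<^sub>v (X *\<^sub>v v)"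
      using X v by (auto simp: contraction_mat_def assoc_mult_mat_vec[of _ n n _ n])
    moreover have "X *\<^sub>v v \<in> carrier_vec n" using X v by (auto simp: contraction_mat_def)
    ultimately show ?thesis
      using X Suc v unfolding contraction_mat_def by (metis order_trans)
  qed
  then show ?case using X by (simp add: contraction_mat_def del: pow_mat.simps)
qed

lemma contraction_mat_quadratic_form_le:
  assumes X: "contraction_mat n X" and v: "v \<in> carrier_vec n"
  shows "v \<bullet> (X *\<^sub>v v) \<le> v \<bullet> v"
proof -
  let ?w = "X *\<^sub>v v"
  have w: "?w \<in> carrier_vec n" using X v by (auto simp: contraction_mat_def)
  have "0 \<le> (v - ?w) \<bullet> (v - ?w)" by (rule scalar_prod_self_nonneg)
  also have "\<dots> = v \<bullet> v - 2 * (v \<bullet> ?w) + ?w \<bullet> ?w"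
    using v w comm_scalar_prod[OF v w]
    by (simp add: minus_scalar_prod_distrib[of _ n] scalar_prod_minus_distrib[of _ n])
  also have "?w \<bullet> ?w \<le> v \<bullet> v" using X v by (auto simp: contraction_mat_def)
  finally show ?thesis by simp
qed

lemma entry_square_le:
  fixes v :: "real vec"
  assumes v: "v \<in> carrier_vec n" and i: "i < n"
  shows "(v $ i)\<^sup>2 \<le> v \<bullet> v"
proof -
  have "(v $ i)\<^sup>2 \<le> (\<Sum>k = 0..<n. (v $ k)\<^sup>2)"
    using i by (intro member_le_sum) auto
  then show ?thesis using v by (simp add: scalar_prod_def power2_eq_square)
qed

lemma contraction_mat_entry_le:
  assumes X: "contraction_mat n X" and ij: "i < n" "j < n"
  shows "\<bar>X $$ (i, j)\<bar> \<le> 1"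
proof -
  let ?w = "X *\<^sub>v unit_vec n j"
  have w: "?w \<in> carrier_vec n" and wi: "?w $ i = X $$ (i, j)"
    using X ij by (auto simp: contraction_mat_def)
  have "(?w $ i)\<^sup>2 \<le> ?w \<bullet> ?w" using w ij(1) by (rule entry_square_le)
  also have "\<dots> \<le> unit_vec n j \<bullet> unit_vec n j"
    using X unfolding contraction_mat_def by (meson unit_vec_carrier)
  also have "\<dots> = 1" using ij by simp
  finally show ?thesis using wi by (simp add: abs_square_le_1)
qed

text \<open>
  This follows from the identity \<open>X - X\<^sup>2 = X (1 - X) X + (1 - X) X (1 - X)\<close>, whose right-hand side is
  positive semidefinite: it gives \<open>X\<^sup>2 \<le> X \<le> 1\<close>.
\<close>
lemma contraction_mat_if_between_0_and_1:
  assumes X: "psd_mat n X" and Y: "psd_mat n (1\<^sub>m n - X)"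
  shows "contraction_mat n X"
proof -
  have Xc: "X \<in> carrier_mat n n" "X\<^sup>T = X" using X by (auto simp: psd_mat_def)
  have "(X *\<^sub>v v) \<bullet> (X *\<^sub>v v) \<le> v \<bullet> v" if v: "v \<in> carrier_vec n" for v
  proof -
    define w where "w = X *\<^sub>v v"
    have w: "w \<in> carrier_vec n" and Xw: "X *\<^sub>v w \<in> carrier_vec n" using Xc v by (auto simp: w_def)
    have vXw: "v \<bullet> (X *\<^sub>v w) = w \<bullet> w"
      using scalar_prod_symmetric_mat[OF Xc v w] by (simp add: w_def)
    have act: "(1\<^sub>m n - X) *\<^sub>v u = u - X *\<^sub>v u" if "u \<in> carrier_vec n" for u
      using that Xc by (simp add: minus_mult_distrib_mat_vec[of _ n n])
    have "0 \<le> w \<bullet> ((1\<^sub>m n - X) *\<^sub>v w)" using Y w by (auto simp: psd_mat_def)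
    also have "\<dots> = w \<bullet> w - w \<bullet> (X *\<^sub>v w)"
      using w Xw by (simp add: act scalar_prod_minus_distrib[of _ n])
    finally have 1: "w \<bullet> (X *\<^sub>v w) \<le> w \<bullet> w" by simp
    have "0 \<le> (v - w) \<bullet> (X *\<^sub>v (v - w))" using X v w by (auto simp: psd_mat_def)
    also have "X *\<^sub>v (v - w) = w - X *\<^sub>v w"
      using Xc v w by (simp add: mult_minus_distrib_mat_vec[of _ n n] w_def)
    also have "(v - w) \<bullet> (w - X *\<^sub>v w) = v \<bullet> w - w \<bullet> w - w \<bullet> w + w \<bullet> (X *\<^sub>v w)"
      using v w Xw vXw by (simp add: minus_scalar_prod_distrib[of _ n] scalar_prod_minus_distrib[of _ n])
    finally have "w \<bullet> w \<le> v \<bullet> w" using 1 by simp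
    moreover have "0 \<le> v \<bullet> ((1\<^sub>m n - X) *\<^sub>v v)" using Y v by (auto simp: psd_mat_def)
    then have "v \<bullet> w \<le> v \<bullet> v"
      using v w by (simp add: act scalar_prod_minus_distrib[of _ n] flip: w_def)
    ultimately show ?thesis by (simp add: w_def)
  qed
  then show ?thesis using Xc by (simp add: contraction_mat_def)
qed

section \<open>Existence of the positive semidefinite square root\<close>

definition sqrt_series :: "real mat \<Rightarrow> real mat" where
  "sqrt_series X = mat (dim_row X) (dim_row X)
     (\<lambda>(i, j). \<Sum>m. sqrt_coeff m * (X ^\<^sub>m m) $$ (i, j))"

lemma summable_sqrt_series_entry:
  assumes X: "contraction_mat n X" and ij: "i < n" "j < n"
  shows "summable (\<lambda>m. norm (sqrt_coeff m * (X ^\<^sub>m m) $$ (i, j)))"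
proof (rule summable_comparison_test')
  show "summable (\<lambda>m. \<bar>sqrt_coeff m\<bar>)" by (rule summable_abs_sqrt_coeff)
  show "norm (norm (sqrt_coeff m * (X ^\<^sub>m m) $$ (i, j))) \<le> \<bar>sqrt_coeff m\<bar>" for m
    using contraction_mat_entry_le[OF contraction_mat_pow[OF X] ij, of m]
    by (simp add: abs_mult mult_left_le)
qed

lemma sqrt_series_carrier: "X \<in> carrier_mat n n \<Longrightarrow> sqrt_series X \<in> carrier_mat n n"
  by (simp add: sqrt_series_def)

lemma sqrt_series_sums:
  assumes X: "contraction_mat n X" and ij: "i < n" "j < n"
  shows "(\<lambda>m. sqrt_coeff m * (X ^\<^sub>m m) $$ (i, j)) sums (sqrt_series X $$ (i, j))"
  using summable_sums[OF summable_norm_cancel[OF summable_sqrt_series_entry[OF assms]]] X ij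
  by (auto simp: sqrt_series_def contraction_mat_def)

text \<open>
  Entry by entry, this is the Cauchy product of absolutely convergent series, with
  \<open>X\<^sup>q X\<^bsup>p - q\<^esup> = X\<^sup>p\<close> and the scalar convolution identity.
\<close>
lemma sqrt_series_square:
  assumes X: "contraction_mat n X"
  shows "sqrt_series X * sqrt_series X = 1\<^sub>m n - X"
proof (rule eq_matI)
  have Xc: "X \<in> carrier_mat n n" using X by (simp add: contraction_mat_def)
  have pc: "X ^\<^sub>m m \<in> carrier_mat n n" for m using Xc by simp
  let ?c = "\<lambda>i j m. sqrt_coeff m * (X ^\<^sub>m m) $$ (i, j)"
  let ?R = "sqrt_series X"
  have Rc: "?R \<in> carrier_mat n n" using Xc by (rule sqrt_series_carrier)
  fix i j assume "i < dim_row (1\<^sub>m n - X)" "j < dim_col (1\<^sub>m n - X)"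
  then have ij: "i < n" "j < n" using Xc by auto
  have "(\<lambda>p. \<Sum>k<n. \<Sum>q\<le>p. ?c i k q * ?c k j (p - q)) sums (\<Sum>k<n. ?R $$ (i, k) * ?R $$ (k, j))"
  proof (rule sums_sum)
    fix k assume "k \<in> {..<n}"
    then have k: "k < n" by simp
    show "(\<lambda>p. \<Sum>q\<le>p. ?c i k q * ?c k j (p - q)) sums (?R $$ (i, k) * ?R $$ (k, j))"
      using Cauchy_product_sums[OF summable_sqrt_series_entry[OF X ij(1) k]
          summable_sqrt_series_entry[OF X k ij(2)]]
        sums_unique[OF sqrt_series_sums[OF X ij(1) k]] sums_unique[OF sqrt_series_sums[OF X k ij(2)]]
      by simp
  qed
  also have "(\<Sum>k<n. ?R $$ (i, k) * ?R $$ (k, j)) = (?R * ?R) $$ (i, j)"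
    using ij Rc by (simp add: scalar_prod_def atLeast0LessThan)
  also have "(\<lambda>p. \<Sum>k<n. \<Sum>q\<le>p. ?c i k q * ?c k j (p - q))
      = (\<lambda>p. (if p = 0 then 1 else if p = 1 then - 1 else 0) * (X ^\<^sub>m p) $$ (i, j))"
  proof
    fix p
    have "(\<Sum>k<n. \<Sum>q\<le>p. ?c i k q * ?c k j (p - q))
        = (\<Sum>q\<le>p. sqrt_coeff q * sqrt_coeff (p - q) *
            (\<Sum>k<n. (X ^\<^sub>m q) $$ (i, k) * (X ^\<^sub>m (p - q)) $$ (k, j)))"
      by (subst sum.swap) (simp add: sum_distrib_left mult_ac)
    also have "\<dots> = (\<Sum>q\<le>p. sqrt_coeff q * sqrt_coeff (p - q) * (X ^\<^sub>m p) $$ (i, j))"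
    proof (rule sum.cong)
      fix q assume q: "q \<in> {..p}"
      have "(\<Sum>k<n. (X ^\<^sub>m q) $$ (i, k) * (X ^\<^sub>m (p - q)) $$ (k, j)) = (X ^\<^sub>m q * X ^\<^sub>m (p - q)) $$ (i, j)"
        using ij Xc by (simp add: scalar_prod_def atLeast0LessThan)
      also have "\<dots> = (X ^\<^sub>m p) $$ (i, j)"
        using q pow_mat_add[OF Xc, of q "p - q"] by simp
      finally show "sqrt_coeff q * sqrt_coeff (p - q) *
            (\<Sum>k<n. (X ^\<^sub>m q) $$ (i, k) * (X ^\<^sub>m (p - q)) $$ (k, j))
          = sqrt_coeff q * sqrt_coeff (p - q) * (X ^\<^sub>m p) $$ (i, j)" by simp
    qed simp
    finally show "(\<Sum>k<n. \<Sum>q\<le>p. ?c i k q * ?c k j (p - q))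
        = (if p = 0 then 1 else if p = 1 then - 1 else 0) * (X ^\<^sub>m p) $$ (i, j)"
      by (simp add: sum_distrib_right[symmetric] sqrt_coeff_convolution)
  qed
  finally have "(\<lambda>p. (if p = 0 then 1 else if p = 1 then - 1 else 0) * (X ^\<^sub>m p) $$ (i, j))
      sums (?R * ?R) $$ (i, j)" .
  moreover have "(\<lambda>p. (if p = 0 then 1 else if p = 1 then - 1 else 0) * (X ^\<^sub>m p) $$ (i, j))
      sums (\<Sum>p\<in>{0, 1}. (if p = 0 then 1 else if p = 1 then - 1 else 0) * (X ^\<^sub>m p) $$ (i, j))"
    by (rule sums_finite) auto
  ultimately have "(?R * ?R) $$ (i, j)
      = (\<Sum>p\<in>{0, 1}. (if p = 0 then 1 else if p = 1 then - 1 else 0) * (X ^\<^sub>m p) $$ (i, j))"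
    by (rule sums_unique2)
  then show "(?R * ?R) $$ (i, j) = (1\<^sub>m n - X) $$ (i, j)"
    using ij Xc by simp
qed (use X in \<open>auto simp: sqrt_series_def contraction_mat_def\<close>)

text \<open>
  Since \<open>v \<bullet> X\<^sup>m v \<le> v \<bullet> v\<close> and all coefficients but the constant one are nonpositive, replacing every
  \<open>X\<^sup>m\<close> by the identity can only decrease the quadratic form of the series; what remains is
  \<open>v \<bullet> v\<close> times the sum of the coefficients.
\<close>
lemma psd_mat_sqrt_series:
  assumes X: "contraction_mat n X" and sym: "X\<^sup>T = X"
  shows "psd_mat n (sqrt_series X)"
proof -
  have Xc: "X \<in> carrier_mat n n" using X by (simp add: contraction_mat_def)
  let ?R = "sqrt_series X"
  have Rc: "?R \<in> carrier_mat n n" using Xc by (rule sqrt_series_carrier)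
  have "(X ^\<^sub>m m) $$ (j, i) = (X ^\<^sub>m m) $$ (i, j)" if "i < n" "j < n" for i j m
    using that Xc transpose_pow_mat[OF Xc, of m] sym
      index_transpose_mat(1)[of i "X ^\<^sub>m m" j] by simp
  then have "?R\<^sup>T = ?R"
    using Xc by (intro eq_matI) (auto simp: sqrt_series_def)
  moreover have "0 \<le> v \<bullet> (?R *\<^sub>v v)" if v: "v \<in> carrier_vec n" for v
  proof -
    have "(\<lambda>m. \<Sum>i<n. \<Sum>j<n. v $ i * v $ j * (sqrt_coeff m * (X ^\<^sub>m m) $$ (i, j)))
        sums (\<Sum>i<n. \<Sum>j<n. v $ i * v $ j * ?R $$ (i, j))"
      by (intro sums_sum sums_mult sqrt_series_sums[OF X]) auto
    also have "(\<lambda>m. \<Sum>i<n. \<Sum>j<n. v $ i * v $ j * (sqrt_coeff m * (X ^\<^sub>m m) $$ (i, j)))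
        = (\<lambda>m. sqrt_coeff m * (v \<bullet> (X ^\<^sub>m m *\<^sub>v v)))"
      using Xc v by (simp add: quadratic_form_eq_sum[of _ n] sum_distrib_left mult_ac)
    also have "(\<Sum>i<n. \<Sum>j<n. v $ i * v $ j * ?R $$ (i, j)) = v \<bullet> (?R *\<^sub>v v)"
      using Rc v by (simp add: quadratic_form_eq_sum[of _ n])
    finally have form: "(\<lambda>m. sqrt_coeff m * (v \<bullet> (X ^\<^sub>m m *\<^sub>v v))) sums (v \<bullet> (?R *\<^sub>v v))" .
    have coeff: "summable sqrt_coeff"
      using summable_abs_sqrt_coeff by (rule summable_rabs_cancel)
    have "0 \<le> suminf sqrt_coeff"
      using summable_LIMSEQ'[OF coeff] by (rule LIMSEQ_le_const) (auto intro: sum_sqrt_coeff_nonneg)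
    then have "0 \<le> suminf sqrt_coeff * (v \<bullet> v)"
      using scalar_prod_self_nonneg[of v] by simp
    also have "\<dots> \<le> v \<bullet> (?R *\<^sub>v v)"
    proof (rule sums_le[OF _ sums_mult2[OF summable_sums[OF coeff]] form])
      fix m
      show "sqrt_coeff m * (v \<bullet> v) \<le> sqrt_coeff m * (v \<bullet> (X ^\<^sub>m m *\<^sub>v v))"
      proof (cases "m = 0")
        case True
        then show ?thesis using Xc v by simp
      next
        case False
        then show ?thesis
          using contraction_mat_quadratic_form_le[OF contraction_mat_pow[OF X] v] sqrt_coeff_nonpos
          by (intro mult_left_mono_neg) auto
      qed
    qed
    finally show ?thesis .
  qed
  ultimately show ?thesis using Rc by (simp add: psd_mat_def)
qed

text \<open>
  A bound for the spectral radius that is visibly a measurable function of the entries.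
\<close>
definition entry_norm :: "real mat \<Rightarrow> real" where
  "entry_norm S = (\<Sum>i<dim_row S. \<Sum>j<dim_col S. \<bar>S $$ (i, j)\<bar>)"

lemma quadratic_form_le_entry_norm:
  assumes S: "S \<in> carrier_mat n n" and v: "v \<in> carrier_vec n"
  shows "v \<bullet> (S *\<^sub>v v) \<le> entry_norm S * (v \<bullet> v)"
proof -
  note sq = entry_square_le[OF v]
  have "v $ i * v $ j * S $$ (i, j) \<le> (v \<bullet> v) * \<bar>S $$ (i, j)\<bar>" if "i < n" "j < n" for i j
  proof -
    have "2 * \<bar>v $ i * v $ j\<bar> \<le> (v $ i)\<^sup>2 + (v $ j)\<^sup>2"
      using sum_squares_bound[of "\<bar>v $ i\<bar>" "\<bar>v $ j\<bar>"] by (simp add: abs_mult)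
    also have "\<dots> \<le> 2 * (v \<bullet> v)" using sq[OF that(1)] sq[OF that(2)] by simp
    finally have "\<bar>v $ i * v $ j\<bar> * \<bar>S $$ (i, j)\<bar> \<le> (v \<bullet> v) * \<bar>S $$ (i, j)\<bar>"
      by (intro mult_right_mono) auto
    then show ?thesis using abs_ge_self[of "v $ i * v $ j * S $$ (i, j)"] by (simp add: abs_mult)
  qed
  then have "(\<Sum>i<n. \<Sum>j<n. v $ i * v $ j * S $$ (i, j)) \<le> (\<Sum>i<n. \<Sum>j<n. (v \<bullet> v) * \<bar>S $$ (i, j)\<bar>)"
    by (intro sum_mono) auto
  then show ?thesis
    using S v by (simp add: quadratic_form_eq_sum[of _ n] entry_norm_def sum_distrib_left mult.commute)
qed

lemma entry_norm_nonneg: "0 \<le> entry_norm S"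
  by (simp add: entry_norm_def sum_nonneg)

lemma psd_mat_smult:
  assumes "psd_mat n S" "0 \<le> c"
  shows "psd_mat n (c \<cdot>\<^sub>m S)"
proof -
  have S: "S \<in> carrier_mat n n" using assms by (simp add: psd_mat_def)
  have "(c \<cdot>\<^sub>m S) *\<^sub>v v = c \<cdot>\<^sub>v (S *\<^sub>v v)" if "v \<in> carrier_vec n" for v
    using S that by (intro eq_vecI) auto
  moreover have "(c \<cdot>\<^sub>m S)\<^sup>T = c \<cdot>\<^sub>m S\<^sup>T"
    by (rule eq_matI) auto
  ultimately show ?thesis
    using assms S by (auto simp: psd_mat_def)
qed

text \<open>
  With \<open>t = 1 + entry_norm S\<close> one has \<open>S = t (1 - X)\<close> for \<open>X\<close> the rescaled defect of \<open>S\<close>, and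
  \<open>0 \<le> X \<le> 1\<close> when \<open>S\<close> is positive semidefinite. Adding 1 keeps \<open>t\<close> positive for \<open>S = 0\<close>.
\<close>
definition rescaled_defect :: "real mat \<Rightarrow> real mat" where
  "rescaled_defect S = 1\<^sub>m (dim_row S) - (1 / (1 + entry_norm S)) \<cdot>\<^sub>m S"

definition scaled_sqrt_series :: "real mat \<Rightarrow> real mat" where
  "scaled_sqrt_series S = sqrt (1 + entry_norm S) \<cdot>\<^sub>m sqrt_series (rescaled_defect S)"

lemma
  assumes S: "psd_mat n S"
  shows psd_mat_scaled_sqrt_series: "psd_mat n (scaled_sqrt_series S)" (is ?psd)
    and scaled_sqrt_series_square: "scaled_sqrt_series S * scaled_sqrt_series S = S" (is ?sq)
proof -
  define t where "t = 1 + entry_norm S"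
  have t: "t > 0" using entry_norm_nonneg[of S] by (simp add: t_def)
  have Sc: "S \<in> carrier_mat n n" "S\<^sup>T = S" using S by (auto simp: psd_mat_def)
  let ?X = "rescaled_defect S"
  have X_eq: "?X = 1\<^sub>m n - (1 / t) \<cdot>\<^sub>m S" using Sc by (simp add: rescaled_defect_def t_def)
  have Xc: "?X \<in> carrier_mat n n" using Sc by (auto simp: X_eq)
  have "S $$ (j, i) = S $$ (i, j)" if "i < n" "j < n" for i j
    using that Sc index_transpose_mat(1)[of i S j] by simp
  then have sym: "?X\<^sup>T = ?X"
    unfolding X_eq using Sc(1) by (intro eq_matI) auto
  have defect: "1\<^sub>m n - ?X = (1 / t) \<cdot>\<^sub>m S"
    unfolding X_eq using Sc by (intro eq_matI) auto
  have "0 \<le> v \<bullet> (?X *\<^sub>v v)" if v: "v \<in> carrier_vec n" for v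
  proof -
    have "?X *\<^sub>v v = v - (1 / t) \<cdot>\<^sub>v (S *\<^sub>v v)"
      unfolding X_eq using Sc v by (intro eq_vecI) (auto simp: minus_mult_distrib_mat_vec[of _ n n])
    then have "v \<bullet> (?X *\<^sub>v v) = v \<bullet> v - (v \<bullet> (S *\<^sub>v v)) / t"
      using Sc v by (simp add: scalar_prod_minus_distrib[of _ n])
    moreover have "v \<bullet> (S *\<^sub>v v) \<le> t * (v \<bullet> v)"
      using quadratic_form_le_entry_norm[OF Sc(1) v] scalar_prod_self_nonneg[of v]
      by (simp add: t_def distrib_right)
    ultimately show ?thesis using t by (simp add: pos_divide_le_eq mult.commute)
  qed
  then have "psd_mat n ?X" using Xc sym by (simp add: psd_mat_def)
  moreover have "psd_mat n (1\<^sub>m n - ?X)"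
    unfolding defect using S t by (intro psd_mat_smult) auto
  ultimately have X: "contraction_mat n ?X" by (rule contraction_mat_if_between_0_and_1)
  show ?psd
    unfolding scaled_sqrt_series_def using psd_mat_sqrt_series[OF X sym] entry_norm_nonneg[of S]
    by (intro psd_mat_smult) auto
  have Rc: "sqrt_series ?X \<in> carrier_mat n n" using Xc by (rule sqrt_series_carrier)
  have "scaled_sqrt_series S * scaled_sqrt_series S = (sqrt t * sqrt t) \<cdot>\<^sub>m (sqrt_series ?X * sqrt_series ?X)"
    unfolding scaled_sqrt_series_def t_def[symmetric]
    using Rc by (intro eq_matI) (auto simp: mult_smult_distrib[of _ n n] mult_smult_assoc_mat[of _ n n])
  also have "\<dots> = t \<cdot>\<^sub>m ((1 / t) \<cdot>\<^sub>m S)"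
    using t by (simp add: sqrt_series_square[OF X] defect)
  also have "\<dots> = S" using t by (intro eq_matI) auto
  finally show ?sq .
qed

text \<open>
  The root is thus given by one explicit formula, a limit of elementary functions of the
  entries of \<open>S\<close>, from which its measurability can be read off.
\<close>
lemma psd_sqrt_eq_scaled_sqrt_series:
  "psd_mat n S \<Longrightarrow> psd_sqrt S = scaled_sqrt_series S"
  by (rule psd_sqrt_eqI[OF psd_mat_scaled_sqrt_series scaled_sqrt_series_square])

section \<open>Measurability of matrix operations\<close>

lemma measurable_borel_mat_entry:
  "X \<in> measurable M (borel_mat nr nc) \<Longrightarrow> i < nr \<Longrightarrow> j < nc \<Longrightarrow>
    (\<lambda>\<omega>. X \<omega> $$ (i, j)) \<in> borel_measurable M"
  by (simp add: measurable_borel_mat_iff)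

lemma measurable_borel_mat_carrier:
  "X \<in> measurable M (borel_mat nr nc) \<Longrightarrow> \<omega> \<in> space M \<Longrightarrow> X \<omega> \<in> carrier_mat nr nc"
  by (auto simp: measurable_borel_mat_iff)

lemma measurable_const_mat:
  "A \<in> carrier_mat nr nc \<Longrightarrow> (\<lambda>_. A) \<in> measurable M (borel_mat nr nc)"
  by (simp add: measurable_borel_mat_iff)

lemma measurable_borel_mat_cong:
  assumes "X \<in> space M \<rightarrow> carrier_mat nr nc"
    and "\<And>i j. i < nr \<Longrightarrow> j < nc \<Longrightarrow> f i j \<in> borel_measurable M"
    and "\<And>\<omega> i j. \<omega> \<in> space M \<Longrightarrow> i < nr \<Longrightarrow> j < nc \<Longrightarrow> X \<omega> $$ (i, j) = f i j \<omega>"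
  shows "X \<in> measurable M (borel_mat nr nc)"
  unfolding measurable_borel_mat_iff
proof (intro conjI allI impI)
  fix i j assume "i < nr" "j < nc"
  then show "(\<lambda>\<omega>. X \<omega> $$ (i, j)) \<in> borel_measurable M"
    using assms(2,3) by (subst measurable_cong[of _ _ "f i j"]) auto
qed (rule assms(1))

lemma measurable_mat_mult:
  assumes X: "X \<in> measurable M (borel_mat n m)" and Y: "Y \<in> measurable M (borel_mat m p)"
  shows "(\<lambda>\<omega>. X \<omega> * Y \<omega>) \<in> measurable M (borel_mat n p)"
proof (rule measurable_borel_mat_cong)
  note c = measurable_borel_mat_carrier[OF X] measurable_borel_mat_carrier[OF Y]
  show "(\<lambda>\<omega>. X \<omega> * Y \<omega>) \<in> space M \<rightarrow> carrier_mat n p"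
    using c by (auto intro!: mult_carrier_mat)
  show "(\<lambda>\<omega>. \<Sum>k<m. X \<omega> $$ (i, k) * Y \<omega> $$ (k, j)) \<in> borel_measurable M"
    if "i < n" "j < p" for i j
    using that measurable_borel_mat_entry[OF X] measurable_borel_mat_entry[OF Y]
    by (intro borel_measurable_sum borel_measurable_times) auto
  show "(X \<omega> * Y \<omega>) $$ (i, j) = (\<Sum>k<m. X \<omega> $$ (i, k) * Y \<omega> $$ (k, j))"
    if "\<omega> \<in> space M" "i < n" "j < p" for \<omega> i j
    using that c[OF that(1)] by (simp add: scalar_prod_def atLeast0LessThan)
qed

lemma measurable_mat_transpose:
  assumes X: "X \<in> measurable M (borel_mat n m)"
  shows "(\<lambda>\<omega>. (X \<omega>)\<^sup>T) \<in> measurable M (borel_mat m n)"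
proof (rule measurable_borel_mat_cong)
  note c = measurable_borel_mat_carrier[OF X]
  show "(\<lambda>\<omega>. (X \<omega>)\<^sup>T) \<in> space M \<rightarrow> carrier_mat m n" using c by auto
  show "(\<lambda>\<omega>. X \<omega> $$ (j, i)) \<in> borel_measurable M" if "i < m" "j < n" for i j
    using that by (intro measurable_borel_mat_entry[OF X])
  show "(X \<omega>)\<^sup>T $$ (i, j) = X \<omega> $$ (j, i)" if "\<omega> \<in> space M" "i < m" "j < n" for \<omega> i j
    using that c[OF that(1)] by simp
qed

lemma measurable_pow_mat:
  assumes X: "X \<in> measurable M (borel_mat n n)"
  shows "(\<lambda>\<omega>. X \<omega> ^\<^sub>m m) \<in> measurable M (borel_mat n n)"
proof (induction m)
  case 0
  have "(\<lambda>\<omega>. 1\<^sub>m n) \<in> measurable M (borel_mat n n)" by (rule measurable_const_mat) simp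
  then show ?case
    by (rule measurable_cong[THEN iffD2, rotated]) (use measurable_borel_mat_carrier[OF X] in auto)
next
  case (Suc m)
  then show ?case using measurable_mat_mult[OF Suc X] by simp
qed

lemma measurable_entry_norm:
  assumes X: "X \<in> measurable M (borel_mat n m)"
  shows "(\<lambda>\<omega>. entry_norm (X \<omega>)) \<in> borel_measurable M"
proof -
  have "(\<lambda>\<omega>. \<Sum>i<n. \<Sum>j<m. \<bar>X \<omega> $$ (i, j)\<bar>) \<in> borel_measurable M"
    by (intro borel_measurable_sum borel_measurable_abs measurable_borel_mat_entry[OF X]) auto
  then show ?thesis
    by (rule measurable_cong[THEN iffD2, rotated])
      (use measurable_borel_mat_carrier[OF X] in \<open>auto simp: entry_norm_def\<close>)
qed

lemma measurable_scaled_sqrt_series: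
  assumes X: "X \<in> measurable M (borel_mat n n)"
  shows "(\<lambda>\<omega>. scaled_sqrt_series (X \<omega>)) \<in> measurable M (borel_mat n n)"
proof -
  note c = measurable_borel_mat_carrier[OF X]
  define Y where "Y = (\<lambda>\<omega>. rescaled_defect (X \<omega>))"
  have Y: "Y \<in> measurable M (borel_mat n n)"
  proof (rule measurable_borel_mat_cong[where
        f = "\<lambda>i j \<omega>. (if i = j then 1 else 0) - 1 / (1 + entry_norm (X \<omega>)) * X \<omega> $$ (i, j)"])
    show "Y \<in> space M \<rightarrow> carrier_mat n n"
      using c by (auto simp: Y_def rescaled_defect_def intro!: minus_carrier_mat smult_carrier_mat)
    show "(\<lambda>\<omega>. (if i = j then 1 else 0) - 1 / (1 + entry_norm (X \<omega>)) * X \<omega> $$ (i, j)) \<in> borel_measurable M"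
      if "i < n" "j < n" for i j
      using that measurable_entry_norm[OF X] measurable_borel_mat_entry[OF X] by measurable
    show "Y \<omega> $$ (i, j) = (if i = j then 1 else 0) - 1 / (1 + entry_norm (X \<omega>)) * X \<omega> $$ (i, j)"
      if "\<omega> \<in> space M" "i < n" "j < n" for \<omega> i j
      using that c[OF that(1)] by (simp add: Y_def rescaled_defect_def)
  qed
  show ?thesis
  proof (rule measurable_borel_mat_cong[where f = "\<lambda>i j \<omega>. sqrt (1 + entry_norm (X \<omega>)) *
      (\<Sum>m. sqrt_coeff m * (Y \<omega> ^\<^sub>m m) $$ (i, j))"])
    show "(\<lambda>\<omega>. scaled_sqrt_series (X \<omega>)) \<in> space M \<rightarrow> carrier_mat n n"
      using measurable_borel_mat_carrier[OF Y]
      by (auto simp: scaled_sqrt_series_def Y_def intro!: smult_carrier_mat sqrt_series_carrier)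
    show "(\<lambda>\<omega>. sqrt (1 + entry_norm (X \<omega>)) * (\<Sum>m. sqrt_coeff m * (Y \<omega> ^\<^sub>m m) $$ (i, j)))
        \<in> borel_measurable M" if "i < n" "j < n" for i j
    proof -
      have "(\<lambda>\<omega>. \<Sum>m. sqrt_coeff m * (Y \<omega> ^\<^sub>m m) $$ (i, j)) \<in> borel_measurable M"
        using that measurable_borel_mat_entry[OF measurable_pow_mat[OF Y]]
        by (intro borel_measurable_suminf borel_measurable_times) auto
      then show ?thesis using measurable_entry_norm[OF X] by measurable
    qed
    show "scaled_sqrt_series (X \<omega>) $$ (i, j)
        = sqrt (1 + entry_norm (X \<omega>)) * (\<Sum>m. sqrt_coeff m * (Y \<omega> ^\<^sub>m m) $$ (i, j))"
      if "\<omega> \<in> space M" "i < n" "j < n" for \<omega> i j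
      using that measurable_borel_mat_carrier[OF Y that(1)]
      by (simp add: scaled_sqrt_series_def sqrt_series_def Y_def)
  qed
qed

lemma measurable_psd_sqrt:
  assumes X: "X \<in> measurable M (borel_mat n n)" and psd: "\<And>\<omega>. \<omega> \<in> space M \<Longrightarrow> psd_mat n (X \<omega>)"
  shows "(\<lambda>\<omega>. psd_sqrt (X \<omega>)) \<in> measurable M (borel_mat n n)"
  using measurable_scaled_sqrt_series[OF X]
  by (rule measurable_cong[THEN iffD2, rotated]) (simp add: psd_sqrt_eq_scaled_sqrt_series[OF psd])

lemma measurable_leading_submatrix:
  assumes X: "X \<in> measurable M (borel_mat n n)" and k: "k \<le> n"
  shows "(\<lambda>\<omega>. leading_submatrix (X \<omega>) k) \<in> measurable M (borel_mat k k)"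
proof (rule measurable_borel_mat_cong[where f = "\<lambda>i j \<omega>. X \<omega> $$ (i, j)"])
  note c = measurable_borel_mat_carrier[OF X]
  show "(\<lambda>\<omega>. leading_submatrix (X \<omega>) k) \<in> space M \<rightarrow> carrier_mat k k"
    using leading_submatrix_eq[OF c k] by auto
  show "(\<lambda>\<omega>. X \<omega> $$ (i, j)) \<in> borel_measurable M" if "i < k" "j < k" for i j
    using that k by (intro measurable_borel_mat_entry[OF X]) auto
  show "leading_submatrix (X \<omega>) k $$ (i, j) = X \<omega> $$ (i, j)"
    if "\<omega> \<in> space M" "i < k" "j < k" for \<omega> i j
    using that leading_submatrix_eq[OF c k] by simp
qed

section \<open>Conditioning on an independent variable\<close>

text \<open>
  The joint law of independent variables is a product measure, so by Fubini the law of
  \<open>h (X, Y)\<close> is the average over \<open>x\<close> of the laws of \<open>h (x, Y)\<close>. Two functions may therefore be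
  compared with the first argument held fixed.
\<close>
lemma (in prob_space) eq_in_distr_of_indep_var:
  assumes indep: "indep_var S X T Y"
    and f: "f \<in> measurable (S \<Otimes>\<^sub>M T) L" and g: "g \<in> measurable (S \<Otimes>\<^sub>M T) L"
    and eq: "\<And>x. x \<in> space S \<Longrightarrow> distr M L (\<lambda>\<omega>. f (x, Y \<omega>)) = distr M L (\<lambda>\<omega>. g (x, Y \<omega>))"
  shows "eq_in_distr M L (\<lambda>\<omega>. f (X \<omega>, Y \<omega>)) (\<lambda>\<omega>. g (X \<omega>, Y \<omega>))"
proof -
  have X: "X \<in> measurable M S" and Y: "Y \<in> measurable M T"
    and joint: "distr M S X \<Otimes>\<^sub>M distr M T Y = distr M (S \<Otimes>\<^sub>M T) (\<lambda>\<omega>. (X \<omega>, Y \<omega>))"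
    using indep by (auto simp: indep_var_distribution_eq)
  have XY: "(\<lambda>\<omega>. (X \<omega>, Y \<omega>)) \<in> measurable M (S \<Otimes>\<^sub>M T)" using X Y by (rule measurable_Pair)
  interpret PY: prob_space "distr M T Y" using Y by (rule prob_space_distr)
  have law: "emeasure (distr M L (\<lambda>\<omega>. h (X \<omega>, Y \<omega>))) E
      = (\<integral>\<^sup>+x. emeasure (distr M L (\<lambda>\<omega>. h (x, Y \<omega>))) E \<partial>distr M S X)"
    if h: "h \<in> measurable (S \<Otimes>\<^sub>M T) L" and E: "E \<in> sets L" for h E
  proof -
    let ?D = "h -` E \<inter> space (S \<Otimes>\<^sub>M T)"
    have D: "?D \<in> sets (distr M S X \<Otimes>\<^sub>M distr M T Y)"
      using measurable_sets[OF h E] by (simp add: joint)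
    have "emeasure (distr M L (\<lambda>\<omega>. h (X \<omega>, Y \<omega>))) E
        = emeasure (distr (distr M (S \<Otimes>\<^sub>M T) (\<lambda>\<omega>. (X \<omega>, Y \<omega>))) L h) E"
      using h XY by (simp add: distr_distr comp_def)
    also have "\<dots> = emeasure (distr M S X \<Otimes>\<^sub>M distr M T Y) ?D"
      unfolding joint using h E by (simp add: emeasure_distr)
    also have "\<dots> = (\<integral>\<^sup>+x. emeasure (distr M T Y) (Pair x -` ?D) \<partial>distr M S X)"
      by (rule PY.emeasure_pair_measure_alt[OF D])
    also have "\<dots> = (\<integral>\<^sup>+x. emeasure (distr M L (\<lambda>\<omega>. h (x, Y \<omega>))) E \<partial>distr M S X)"
    proof (rule nn_integral_cong)
      fix x assume "x \<in> space (distr M S X)"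
      then have x: "x \<in> space S" by simp
      have hx: "(\<lambda>y. h (x, y)) \<in> measurable T L"
        using measurable_compose[OF measurable_Pair1'[OF x] h] .
      have "Pair x -` ?D = (\<lambda>y. h (x, y)) -` E \<inter> space T"
        using x by (auto simp: space_pair_measure)
      then have "emeasure (distr M T Y) (Pair x -` ?D) = emeasure (distr (distr M T Y) L (\<lambda>y. h (x, y))) E"
        using hx E by (simp add: emeasure_distr)
      also have "\<dots> = emeasure (distr M L (\<lambda>\<omega>. h (x, Y \<omega>))) E"
        using hx Y by (simp add: distr_distr comp_def)
      finally show "emeasure (distr M T Y) (Pair x -` ?D) = emeasure (distr M L (\<lambda>\<omega>. h (x, Y \<omega>))) E" .
    qed
    finally show ?thesis .
  qed
  have "distr M L (\<lambda>\<omega>. f (X \<omega>, Y \<omega>)) = distr M L (\<lambda>\<omega>. g (X \<omega>, Y \<omega>))"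
  proof (rule measure_eqI)
    fix E assume "E \<in> sets (distr M L (\<lambda>\<omega>. f (X \<omega>, Y \<omega>)))"
    then have "E \<in> sets L" by simp
    then show "emeasure (distr M L (\<lambda>\<omega>. f (X \<omega>, Y \<omega>))) E = emeasure (distr M L (\<lambda>\<omega>. g (X \<omega>, Y \<omega>))) E"
      by (simp add: law[OF f] law[OF g] eq cong: nn_integral_cong_simp)
  qed simp
  then show ?thesis
    using measurable_compose[OF XY f] measurable_compose[OF XY g] by (simp add: eq_in_distr_def)
qed

section \<open>Polar decomposition of the leading rows\<close>

definition coordinate_projection :: "nat \<Rightarrow> nat \<Rightarrow> real mat" where
  "coordinate_projection k n = mat k n (\<lambda>(i, j). if i = j then 1 else 0)"

lemma coordinate_projection_carrier: "coordinate_projection k n \<in> carrier_mat k n"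
  by (simp add: coordinate_projection_def)

lemma coordinate_projection_mult:
  assumes X: "X \<in> carrier_mat n m" and k: "k \<le> n"
  shows "coordinate_projection k n * X = mat k m (\<lambda>(i, j). X $$ (i, j))"
proof (rule eq_matI)
  fix i j
  assume "i < dim_row (mat k m (\<lambda>(i, j). X $$ (i, j)))" "j < dim_col (mat k m (\<lambda>(i, j). X $$ (i, j)))"
  then have ij: "i < k" "i < n" "j < m" using k by auto
  have "(coordinate_projection k n * X) $$ (i, j) = (\<Sum>l\<in>{0..<n}. (if i = l then 1 else 0) * X $$ (l, j))"
    using ij X by (simp add: coordinate_projection_def scalar_prod_def)
  also have "\<dots> = X $$ (i, j)"
    using ij by (simp add: if_distrib[of "\<lambda>c. c * _"] cong: if_cong)
  finally show "(coordinate_projection k n * X) $$ (i, j) = mat k m (\<lambda>(i, j). X $$ (i, j)) $$ (i, j)"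
    using ij by simp
qed (use X in \<open>auto simp: coordinate_projection_def\<close>)

lemma leading_submatrix_eq_projection:
  assumes X: "X \<in> carrier_mat n n" and k: "k \<le> n"
  shows "leading_submatrix X k = coordinate_projection k n * X * (coordinate_projection k n)\<^sup>T"
proof -
  let ?P = "coordinate_projection k n"
  have P: "?P \<in> carrier_mat k n" by (rule coordinate_projection_carrier)
  have "?P * X * ?P\<^sup>T = (?P * (?P * X)\<^sup>T)\<^sup>T"
    using P X by (simp add: transpose_mult[of _ k n _ n] transpose_mult[of _ n n _ k] transpose_mult[of _ k n _ k]
        assoc_mult_mat[of _ k n _ n _ k])
  also have "\<dots> = mat k k (\<lambda>(i, j). X $$ (i, j))"
    using X k
    by (subst coordinate_projection_mult[of _ n k]) (auto simp: coordinate_projection_mult[of X n n k])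
  finally show ?thesis using leading_submatrix_eq[OF X k] by simp
qed

lemma coordinate_projection_mult_transpose:
  "k \<le> n \<Longrightarrow> coordinate_projection k n * (coordinate_projection k n)\<^sup>T = 1\<^sub>m k"
  by (subst coordinate_projection_mult[of _ n k])
    (auto simp: coordinate_projection_def intro!: eq_matI)

lemma psd_mat_mult_transpose:
  assumes C: "(C :: real mat) \<in> carrier_mat k n"
  shows "psd_mat k (C * C\<^sup>T)"
proof -
  have "v \<bullet> ((C * C\<^sup>T) *\<^sub>v v) = (C\<^sup>T *\<^sub>v v) \<bullet> (C\<^sup>T *\<^sub>v v)" if v: "v \<in> carrier_vec k" for v
    using C v transpose_vec_mult_scalar[OF C, of "C\<^sup>T *\<^sub>v v" v] by simp
  then show ?thesis
    using C scalar_prod_self_nonneg by (simp add: psd_mat_def transpose_mult[of _ k n])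
qed

text \<open>
  With \<open>R = (C C\<^sup>T)\<^bsup>1/2\<^esup>\<close> and \<open>P\<close> the coordinate projection, the rows of \<open>R P\<close> have the same scalar products as the
  rows of \<open>C\<close>, both Gram matrices being \<open>C C\<^sup>T = R\<^sup>2\<close>; an orthogonal matrix therefore carries the
  former to the latter.
\<close>
lemma polar_decomposition:
  assumes C: "C \<in> carrier_mat k n" and k: "k \<le> n"
  shows "\<exists>U. orthogonal_matrix_real n U \<and>
    C = psd_sqrt (C * C\<^sup>T) * coordinate_projection k n * U"
proof -
  let ?R = "psd_sqrt (C * C\<^sup>T)" and ?P = "coordinate_projection k n"
  have psd: "psd_mat k (C * C\<^sup>T)" using C by (rule psd_mat_mult_transpose)
  have R: "psd_mat k ?R" "?R * ?R = C * C\<^sup>T"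
    using psd_mat_scaled_sqrt_series[OF psd] scaled_sqrt_series_square[OF psd]
    by (simp_all add: psd_sqrt_eq_scaled_sqrt_series[OF psd])
  have Rc: "?R \<in> carrier_mat k k" "?R\<^sup>T = ?R" using R by (auto simp: psd_mat_def)
  have P: "?P \<in> carrier_mat k n" by (rule coordinate_projection_carrier)
  have "(?P\<^sup>T * ?R)\<^sup>T * (?P\<^sup>T * ?R) = ?R * (?P * ?P\<^sup>T) * ?R"
    using P Rc by (simp add: transpose_mult[of _ n k] assoc_mult_mat[of _ k k _ n _ k]
        assoc_mult_mat[of _ k n _ k _ k] assoc_mult_mat[of _ k k _ k _ k])
  also have "\<dots> = C * C\<^sup>T"
    using Rc R by (simp add: coordinate_projection_mult_transpose[OF k])
  finally have gram: "(C\<^sup>T)\<^sup>T * C\<^sup>T = (?P\<^sup>T * ?R)\<^sup>T * (?P\<^sup>T * ?R)" by simp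
  obtain W where W: "orthogonal_matrix_real n W" "W * (?P\<^sup>T * ?R) = C\<^sup>T"
    using orthogonal_matrix_of_equal_gram[OF _ _ gram, of n k] C P Rc by auto
  have Wc: "W \<in> carrier_mat n n" using W by (simp add: orthogonal_matrix_real_def)
  have "C = (W * (?P\<^sup>T * ?R))\<^sup>T" by (simp add: W)
  also have "\<dots> = ?R * ?P * W\<^sup>T"
    using Wc P Rc by (simp add: transpose_mult[of _ n n _ k] transpose_mult[of _ n k _ k]
        assoc_mult_mat[of _ k k _ n _ n])
  finally show ?thesis using orthogonal_matrix_real_transpose[OF W(1)] by blast
qed

lemma leading_submatrix_conjugation:
  assumes a: "a \<in> carrier_mat n n" and b: "b \<in> carrier_mat n n" and k: "k \<le> n"
  shows "leading_submatrix (a * b * a\<^sup>T) k =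
    (coordinate_projection k n * a) * b * (coordinate_projection k n * a)\<^sup>T"
  using a b k coordinate_projection_carrier[of k n] leading_submatrix_eq_projection[of "a * b * a\<^sup>T" n k]
  by (simp add: transpose_mult[of _ k n] assoc_mult_mat[of _ k n _ n _ n]
      assoc_mult_mat[of _ k n _ n _ k] assoc_mult_mat[of _ n n _ n _ n] assoc_mult_mat[of _ n n _ n _ k])

lemma leading_submatrix_mult_transpose:
  assumes a: "a \<in> carrier_mat n n" and k: "k \<le> n"
  shows "leading_submatrix (a * a\<^sup>T) k =
    (coordinate_projection k n * a) * (coordinate_projection k n * a)\<^sup>T"
  using leading_submatrix_conjugation[OF a one_carrier_mat k] a
    right_mult_one_mat[OF mult_carrier_mat[OF coordinate_projection_carrier a]] by simp

text \<open>
  The first \<open>k\<close> rows of \<open>a\<close> are \<open>R P U\<close> by polar decomposition, and \<open>P (U b U\<^sup>T) P\<^sup>T\<close> is the leading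
  submatrix of \<open>U b U\<^sup>T\<close>. The point is that one \<open>U\<close>, depending on \<open>a\<close> only, serves all \<open>b\<close>.
\<close>
lemma leading_submatrix_sandwich:
  assumes a: "a \<in> carrier_mat n n" and k: "k \<le> n"
  defines "R \<equiv> psd_sqrt (leading_submatrix (a * a\<^sup>T) k)"
  shows "\<exists>U. orthogonal_matrix_real n U \<and> (\<forall>b\<in>carrier_mat n n.
    leading_submatrix (a * b * a\<^sup>T) k = R * leading_submatrix (U * b * U\<^sup>T) k * R)"
proof -
  let ?P = "coordinate_projection k n"
  define C where "C = ?P * a"
  have P: "?P \<in> carrier_mat k n" by (rule coordinate_projection_carrier)
  have C: "C \<in> carrier_mat k n" using P a by (simp add: C_def)
  note lead = leading_submatrix_conjugation[OF a _ k, folded C_def]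
  have "leading_submatrix (a * a\<^sup>T) k = C * C\<^sup>T"
    unfolding C_def using a k by (rule leading_submatrix_mult_transpose)
  then have R_def': "R = psd_sqrt (C * C\<^sup>T)" by (simp add: R_def)
  have psd: "psd_mat k (C * C\<^sup>T)" using C by (rule psd_mat_mult_transpose)
  have R: "R \<in> carrier_mat k k" "R\<^sup>T = R"
    using psd_mat_scaled_sqrt_series[OF psd]
    by (simp_all add: R_def' psd_sqrt_eq_scaled_sqrt_series[OF psd] psd_mat_def)
  obtain U where U: "orthogonal_matrix_real n U" "C = R * ?P * U"
    using polar_decomposition[OF C k] by (auto simp: R_def')
  have Uc: "U \<in> carrier_mat n n" using U by (simp add: orthogonal_matrix_real_def)
  have "leading_submatrix (a * b * a\<^sup>T) k = R * leading_submatrix (U * b * U\<^sup>T) k * R"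
    if b: "b \<in> carrier_mat n n" for b
  proof -
    have "C\<^sup>T = U\<^sup>T * (?P\<^sup>T * R)"
      using Uc P R by (simp add: U(2) transpose_mult[of _ k k _ n] transpose_mult[of _ k n _ n]
          assoc_mult_mat[of _ n n _ k _ k] assoc_mult_mat[of _ k k _ n _ n])
    then have "C * b * C\<^sup>T = R * (?P * (U * b * U\<^sup>T) * ?P\<^sup>T) * R"
      using U(2) Uc P R b
      by (simp add: assoc_mult_mat[of _ k k _ n _ n] assoc_mult_mat[of _ k n _ n _ n]
          assoc_mult_mat[of _ k n _ n _ k] assoc_mult_mat[of _ n n _ n _ n]
          assoc_mult_mat[of _ n n _ n _ k] assoc_mult_mat[of _ k k _ n _ k]
          assoc_mult_mat[of _ k k _ k _ k] assoc_mult_mat[of _ n n _ k _ k]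
          assoc_mult_mat[of _ k n _ k _ k] assoc_mult_mat[of _ n k _ k _ k])
    then show ?thesis
      using b Uc k by (simp add: lead[OF b] leading_submatrix_eq_projection[of _ n k])
  qed
  then show ?thesis using U(1) by blast
qed

section \<open>Leading submatrices of an orthogonally invariant matrix\<close>

theorem corollary4p5:
  fixes M :: "'a measure" and N :: nat and A B :: "'a \<Rightarrow> real mat"
  assumes "prob_space M"
    and "A \<in> measurable M (borel_mat N N)"
    and "B \<in> measurable M (borel_mat N N)"
    and "prob_space.indep_var M (borel_mat N N) A (borel_mat N N) B"
    and "orthogonally_invariant M N B"
  shows "\<forall>k\<in>{1..N}.
    eq_in_distr M (borel_mat k k)
      (\<lambda>\<omega>. leading_submatrix (A \<omega> * B \<omega> * (A \<omega>)\<^sup>T) k)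
      (\<lambda>\<omega>. psd_sqrt (leading_submatrix (A \<omega> * (A \<omega>)\<^sup>T) k)
            * leading_submatrix (B \<omega>) k
            * psd_sqrt (leading_submatrix (A \<omega> * (A \<omega>)\<^sup>T) k))"
proof
  fix k assume "k \<in> {1..N}"
  then have k: "k \<le> N" by simp
  interpret prob_space M by fact
  let ?L = "borel_mat N N" and ?Lk = "borel_mat k k"
  let ?R = "\<lambda>a. psd_sqrt (leading_submatrix (a * a\<^sup>T) k)"
  define f where "f = (\<lambda>(a, b). leading_submatrix (a * b * a\<^sup>T) k :: real mat)"
  define g where "g = (\<lambda>(a, b). ?R a * leading_submatrix b k * ?R a)"
  have fst: "fst \<in> measurable (?L \<Otimes>\<^sub>M ?L) ?L" and snd: "snd \<in> measurable (?L \<Otimes>\<^sub>M ?L) ?L"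
    by (rule measurable_fst, rule measurable_snd)
  have f: "f \<in> measurable (?L \<Otimes>\<^sub>M ?L) ?Lk"
    unfolding f_def case_prod_beta
    by (intro measurable_leading_submatrix[OF _ k] measurable_mat_mult[where m = N]
        measurable_mat_transpose fst snd)
  have psd: "psd_mat k (leading_submatrix (a * a\<^sup>T) k)" if "a \<in> carrier_mat N N" for a :: "real mat"
    using that psd_mat_mult_transpose[of "coordinate_projection k N * a" k N]
      coordinate_projection_carrier[of k N]
    by (simp add: leading_submatrix_mult_transpose[OF that k])
  have R_meas: "(\<lambda>p. ?R (fst p)) \<in> measurable (?L \<Otimes>\<^sub>M ?L) ?Lk"
    by (intro measurable_psd_sqrt psd measurable_leading_submatrix[OF _ k] measurable_mat_mult[where m = N]
        measurable_mat_transpose fst) (auto simp: space_pair_measure space_borel_mat)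
  have g: "g \<in> measurable (?L \<Otimes>\<^sub>M ?L) ?Lk"
    unfolding g_def case_prod_beta
    by (intro measurable_mat_mult[where m = k] R_meas measurable_leading_submatrix[OF _ k] snd)
  have "eq_in_distr M ?Lk (\<lambda>\<omega>. f (A \<omega>, B \<omega>)) (\<lambda>\<omega>. g (A \<omega>, B \<omega>))"
  proof (rule eq_in_distr_of_indep_var[OF assms(4) f g])
    fix a assume "a \<in> space ?L"
    then have a: "a \<in> carrier_mat N N" by (simp add: space_borel_mat)
    \<comment> \<open>As \<open>a\<close> is fixed, so is \<open>U\<close>, and the invariance of \<open>B\<close> under deterministic matrices applies.\<close>
    obtain U where U: "orthogonal_matrix_real N U"
      and sandwich: "\<And>b. b \<in> carrier_mat N N \<Longrightarrow>
        leading_submatrix (a * b * a\<^sup>T) k = ?R a * leading_submatrix (U * b * U\<^sup>T) k * ?R a"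
      using leading_submatrix_sandwich[OF a k] by blast
    have inv: "(\<lambda>\<omega>. U * B \<omega> * U\<^sup>T) \<in> measurable M ?L"
      "distr M ?L (\<lambda>\<omega>. U * B \<omega> * U\<^sup>T) = distr M ?L B"
      using assms(5) U by (auto simp: orthogonally_invariant_def eq_in_distr_def)
    have h: "(\<lambda>b. g (a, b)) \<in> measurable ?L ?Lk"
      using measurable_compose[OF measurable_Pair1'[OF \<open>a \<in> space ?L\<close>] g] .
    have "distr M ?Lk (\<lambda>\<omega>. f (a, B \<omega>)) = distr M ?Lk (\<lambda>\<omega>. g (a, U * B \<omega> * U\<^sup>T))"
      using measurable_borel_mat_carrier[OF assms(3)]
      by (intro distr_cong) (auto simp: f_def g_def sandwich)
    also have "\<dots> = distr (distr M ?L (\<lambda>\<omega>. U * B \<omega> * U\<^sup>T)) ?Lk (\<lambda>b. g (a, b))"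
      using h inv(1) by (simp add: distr_distr comp_def)
    also have "\<dots> = distr M ?Lk (\<lambda>\<omega>. g (a, B \<omega>))"
      using h assms(3) by (simp add: inv(2) distr_distr comp_def)
    finally show "distr M ?Lk (\<lambda>\<omega>. f (a, B \<omega>)) = distr M ?Lk (\<lambda>\<omega>. g (a, B \<omega>))" .
  qed
  then show "eq_in_distr M ?Lk
      (\<lambda>\<omega>. leading_submatrix (A \<omega> * B \<omega> * (A \<omega>)\<^sup>T) k)
      (\<lambda>\<omega>. ?R (A \<omega>) * leading_submatrix (B \<omega>) k * ?R (A \<omega>))"
    by (simp add: f_def g_def)
qed

end
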